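(* Let $n\ge 2$ be an integer, let $T=(T_{ijk})_{1\le i,j\le n,\,1\le k\le 2}$ be an $n\times n\times 2$-tensor of independent indeterminates over $\mathbb{C}$, $X=(T_{ij1})$, $Y=(T_{ij2})$, and write $\det(X+Y)=\sum_{k=0}^n f_{k,n-k}$, where $f_{k,n-k}$ is the sum of the terms of degree $k$ in the $T_{ij1}$ and degree $n-k$ in the $T_{ij2}$. Let $U_0,U_1,\ldots,U_n$ be indeterminates, and equip $\mathbb{C}[U_0,\ldots,U_n]$ with the degree reverse lexicographic order with $U_n>U_{n-1}>\cdots>U_0$. Let $\Phi(U_0,U_1,\ldots,U_n)$ be the element of $\mathbb{C}[U_0,\ldots,U_n]$ such that $\Phi(f_{0,n},f_{1,n-1},\ldots,f_{n,0})$ (i.e. $U_k$ is replaced by $f_{k,n-k}$) is the hyperdeterminant of format $n-1,n-1,1$. Then $$\mathrm{supp}(\mathrm{lm}(\Phi))\cap\{U_0,U_1\}\neq\emptyset.$$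
   Context: Hyperdeterminant (Gelfand–Kapranov–Zelevinsky): for positive integers $l_1,\ldots,l_d$ let $V$ be the image of the Segre embedding $\mathbb{P}_{\mathbb{C}}^{l_1}\times\cdots\times\mathbb{P}_{\mathbb{C}}^{l_d}\to\mathbb{P}_{\mathbb{C}}^{(l_1+1)\cdots(l_d+1)-1}$. If the projective dual variety $V^\vee$ (in the dual projective space) is a hypersurface, its defining polynomial (unique up to a nonzero scalar) is called the hyperdeterminant of format $l_1,\ldots,l_d$; it is a polynomial in the entries of an $(l_1+1)\times\cdots\times(l_d+1)$-tensor of indeterminates, where the entry $T_{i_1\cdots i_d}$ is the coordinate function giving the coefficient of $x^{(1)}_{i_1}\cdots x^{(d)}_{i_d}$ in the multilinear form defining a hyperplane. It is known that the hyperdeterminant of format $l_1,\ldots,l_d$ exists if and only if $l_k\le\sum_{j\ne k}l_j$ for all $k$ (so it exists for format $n-1,n-1,1$ with $n\geq 2$), and that it is invariant under $\mathrm{SL}(l_1+1,\mathbb{C})\times\cdots\times\mathrm{SL}(l_d+1,\mathbb{C})$. The polynomials $f_{0,n},\ldots,f_{n,0}$ are algebraically independent and generate $\mathbb{C}[T]^{\mathrm{SL}(n,\mathbb{C})\times\mathrm{SL}(n,\mathbb{C})}$, where $(P,Q)$ sends $X\mapsto P^\top XQ$, $Y\mapsto P^\top YQ$; hence $\Phi$ exists and is unique (once the hyperdeterminant is fixed up to scalar). $\mathrm{lm}$ denotes the leading monomial, and for a monomial $g$, $\mathrm{supp}(g)$ is the set of indeterminates occurring in $g$ with positive exponent. 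*)

theory Defs
  imports
    "HOL-Library.Poly_Mapping"
    "HOL-Library.Function_Algebras"
    "HOL-Analysis.Derivative"
    "Jordan_Normal_Form.Determinant"
begin

section \<open>Polynomials over the complex numbers\<close>

text \<open>A monomial is a finitely supported exponent function.\<close>

type_synonym 'v monomial = "'v \<Rightarrow>\<^sub>0 nat"
type_synonym 'v cpoly = "'v monomial \<Rightarrow>\<^sub>0 complex"

definition supp :: "'v monomial \<Rightarrow> 'v set" where
  "supp m = Poly_Mapping.keys m"

definition monomials :: "'v cpoly \<Rightarrow> 'v monomial set" where
  "monomials p = Poly_Mapping.keys p"

abbreviation expo :: "'v monomial \<Rightarrow> 'v \<Rightarrow> nat" where
  "expo \<equiv> Poly_Mapping.lookup"

abbreviation coeff_of :: "'v cpoly \<Rightarrow> 'v monomial \<Rightarrow> complex" where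
  "coeff_of \<equiv> Poly_Mapping.lookup"

definition Var :: "'v \<Rightarrow> 'v cpoly" where
  "Var v = Poly_Mapping.single (Poly_Mapping.single v 1) 1"

definition Const :: "complex \<Rightarrow> 'v cpoly" where
  "Const c = Poly_Mapping.single 0 c"

definition polys_in :: "'v set \<Rightarrow> 'v cpoly set" where
  "polys_in I = {p. \<forall>m\<in>monomials p. supp m \<subseteq> I}"

definition eval_poly :: "('v \<Rightarrow> complex) \<Rightarrow> 'v cpoly \<Rightarrow> complex" where
  "eval_poly a p = (\<Sum>m\<in>monomials p. coeff_of p m * (\<Prod>v\<in>supp m. a v ^ expo m v))"

definition subst_poly :: "('v \<Rightarrow> 'w cpoly) \<Rightarrow> 'v cpoly \<Rightarrow> 'w cpoly" where
  "subst_poly s p = (\<Sum>m\<in>monomials p. Const (coeff_of p m) * (\<Prod>v\<in>supp m. s v ^ expo m v))"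


section \<open>Projective spaces, varieties and dual varieties\<close>

text \<open>Vectors in \<open>\<complex>\<^sup>I\<close> are functions vanishing outside \<open>I\<close>.\<close>

definition vecs :: "'v set \<Rightarrow> ('v \<Rightarrow> complex) set" where
  "vecs I = {a. \<forall>i. i \<notin> I \<longrightarrow> a i = 0}"

text \<open>A point of projective space is the set of all its homogeneous coordinate vectors.\<close>

definition proj_point :: "('v \<Rightarrow> complex) \<Rightarrow> ('v \<Rightarrow> complex) set" where
  "proj_point a = {(\<lambda>i. c * a i) | c. c \<noteq> 0}"

definition proj_space :: "'v set \<Rightarrow> ('v \<Rightarrow> complex) set set" where
  "proj_space I = {proj_point a | a. a \<in> vecs I \<and> a \<noteq> 0}"

text \<open>A polynomial, homogeneous or not, vanishes at a projective point if it vanishes at all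
  homogeneous coordinate vectors of the point; this holds iff all its homogeneous components
  vanish there. So \<open>vanishing_ideal I Z\<close> is the usual homogeneous ideal.\<close>

definition vanishes_at :: "'v cpoly \<Rightarrow> ('v \<Rightarrow> complex) set \<Rightarrow> bool" where
  "vanishes_at F p \<longleftrightarrow> (\<forall>u\<in>p. eval_poly u F = 0)"

definition vanishing_ideal :: "'v set \<Rightarrow> ('v \<Rightarrow> complex) set set \<Rightarrow> 'v cpoly set" where
  "vanishing_ideal I Z = {F \<in> polys_in I. \<forall>p\<in>Z. vanishes_at F p}"

definition zero_locus :: "'v set \<Rightarrow> 'v cpoly set \<Rightarrow> ('v \<Rightarrow> complex) set set" where
  "zero_locus I S = {p \<in> proj_space I. \<forall>F\<in>S. vanishes_at F p}"

definition zariski_closure ::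
    "'v set \<Rightarrow> ('v \<Rightarrow> complex) set set \<Rightarrow> ('v \<Rightarrow> complex) set set" where
  "zariski_closure I Z = zero_locus I (vanishing_ideal I Z)"

text \<open>The linear subspace of \<open>\<complex>\<^sup>I\<close> whose projectivization is the embedded projective tangent
  space of \<open>V\<close> at \<open>p\<close>: the vectors annihilated by the differentials at \<open>p\<close> of all polynomials
  in the ideal of \<open>V\<close>.\<close>

definition tangent_space ::
    "'v set \<Rightarrow> ('v \<Rightarrow> complex) set set \<Rightarrow> ('v \<Rightarrow> complex) set \<Rightarrow> ('v \<Rightarrow> complex) set" where
  "tangent_space I V p = {w \<in> vecs I. \<forall>F\<in>vanishing_ideal I V. \<forall>u\<in>p.
     deriv (\<lambda>t. eval_poly (\<lambda>i. u i + t * w i) F) 0 = 0}"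

definition cdimension :: "('v \<Rightarrow> complex) set \<Rightarrow> nat" where
  "cdimension W = vector_space.dim (\<lambda>(c::complex) w i. c * w i) W"

text \<open>For an irreducible variety \<open>V\<close>, the nonsingular points are those at which the tangent
  space has the minimal dimension.\<close>

definition smooth_points ::
    "'v set \<Rightarrow> ('v \<Rightarrow> complex) set set \<Rightarrow> ('v \<Rightarrow> complex) set set" where
  "smooth_points I V =
     {p \<in> V. \<forall>q\<in>V. cdimension (tangent_space I V p) \<le> cdimension (tangent_space I V q)}"

definition hyperplane :: "'v set \<Rightarrow> ('v \<Rightarrow> complex) \<Rightarrow> ('v \<Rightarrow> complex) set" where
  "hyperplane I a = {w \<in> vecs I. (\<Sum>i\<in>I. a i * w i) = 0}"

text \<open>The closure of the set of hyperplanes tangent to \<open>V\<close> at a smooth point. The dual projective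
  space has the coefficients of linear forms as homogeneous coordinates, so that it is again
  \<open>proj_space I\<close>.\<close>

definition dual_variety ::
    "'v set \<Rightarrow> ('v \<Rightarrow> complex) set set \<Rightarrow> ('v \<Rightarrow> complex) set set" where
  "dual_variety I V = zariski_closure I
     {proj_point a | a. a \<in> vecs I \<and> a \<noteq> 0 \<and>
        (\<exists>p\<in>smooth_points I V. tangent_space I V p \<subseteq> hyperplane I a)}"

text \<open>\<open>Z\<close> is a hypersurface and \<open>F\<close> generates its ideal.\<close>

definition is_defining_polynomial ::
    "'v set \<Rightarrow> ('v \<Rightarrow> complex) set set \<Rightarrow> 'v cpoly \<Rightarrow> bool" where
  "is_defining_polynomial I Z F \<longleftrightarrow>
     F \<in> polys_in I \<and> F \<notin> range Const \<and>
     Z = zero_locus I {F} \<and>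
     vanishing_ideal I Z = {G * F | G. G \<in> polys_in I}"


section \<open>Hyperdeterminants\<close>

text \<open>The format is the list \<open>l = [l\<^sub>1, \<dots>, l\<^sub>d]\<close>; the multi-index \<open>[i\<^sub>1, \<dots>, i\<^sub>d]\<close> with
  \<open>1 \<le> i\<^sub>k \<le> l\<^sub>k + 1\<close> serves as the name of the indeterminate with these subscripts.\<close>

definition multi_indices :: "nat list \<Rightarrow> nat list set" where
  "multi_indices l =
     {is. length is = length l \<and> (\<forall>k<length l. 1 \<le> is ! k \<and> is ! k \<le> l ! k + 1)}"

definition segre_vec :: "nat list \<Rightarrow> (nat \<Rightarrow> nat \<Rightarrow> complex) \<Rightarrow> nat list \<Rightarrow> complex" where
  "segre_vec l x = (\<lambda>is. if is \<in> multi_indices l then (\<Prod>k<length l. x k (is ! k)) else 0)"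

definition segre_variety :: "nat list \<Rightarrow> (nat list \<Rightarrow> complex) set set" where
  "segre_variety l =
     {proj_point (segre_vec l x) | x. \<forall>k<length l. x k \<in> vecs {1..l ! k + 1} \<and> x k \<noteq> 0}"

definition is_hyperdeterminant :: "nat list \<Rightarrow> nat list cpoly \<Rightarrow> bool" where
  "is_hyperdeterminant l F \<longleftrightarrow>
     is_defining_polynomial (multi_indices l) (dual_variety (multi_indices l) (segre_variety l)) F"


section \<open>The slices of the tensor and their mixed determinants\<close>

text \<open>Matrices are indexed from 0, the entries of the tensor from 1.\<close>

definition slice :: "nat \<Rightarrow> nat \<Rightarrow> nat list cpoly mat" where
  "slice n s = mat n n (\<lambda>(i, j). Var [i + 1, j + 1, s])"

abbreviation "matX n \<equiv> slice n 1"
abbreviation "matY n \<equiv> slice n 2"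

definition slice_degree :: "nat \<Rightarrow> nat \<Rightarrow> nat list monomial \<Rightarrow> nat" where
  "slice_degree n s m = (\<Sum>i=1..n. \<Sum>j=1..n. expo m [i, j, s])"

definition bihomogeneous_part ::
    "nat \<Rightarrow> nat \<Rightarrow> nat \<Rightarrow> nat list cpoly \<Rightarrow> nat list cpoly" where
  "bihomogeneous_part n a b p =
     (\<Sum>m\<in>{m \<in> monomials p. slice_degree n 1 m = a \<and> slice_degree n 2 m = b}.
        Poly_Mapping.single m (coeff_of p m))"

text \<open>\<open>mixed_det n k\<close> is the polynomial $f_{k,n-k}$.\<close>

definition mixed_det :: "nat \<Rightarrow> nat \<Rightarrow> nat list cpoly" where
  "mixed_det n k = bihomogeneous_part n k (n - k) (det (matX n + matY n))"


section \<open>Degree reverse lexicographic order\<close>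

definition total_degree :: "nat monomial \<Rightarrow> nat" where
  "total_degree m = (\<Sum>k\<in>supp m. expo m k)"

text \<open>The indeterminate $U_k$ is named \<open>k\<close>. Since $\cdots > U_1 > U_0$, ties in the degree are
  decided by the least \<open>k\<close> at which the exponents differ, and the monomial with the larger
  exponent there is the smaller one.\<close>

definition degrevlex_less :: "nat monomial \<Rightarrow> nat monomial \<Rightarrow> bool" where
  "degrevlex_less a b \<longleftrightarrow>
     total_degree a < total_degree b \<or>
     total_degree a = total_degree b \<and>
       (\<exists>k. expo a k > expo b k \<and> (\<forall>j<k. expo a j = expo b j))"

definition lm :: "nat cpoly \<Rightarrow> nat monomial" where
  "lm p = (THE m. m \<in> monomials p \<and> (\<forall>m'\<in>monomials p. m' \<noteq> m \<longrightarrow> degrevlex_less m' m))"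

end

theory Submission
  imports Defs "HOL-Computational_Algebra.Fundamental_Theorem_Algebra"
begin

text \<open>The hyperdeterminant of format \<open>n - 1, n - 1, 1\<close> is the discriminant of the binary form
  \<open>det (s X + t Y)\<close>, but only its vanishing at forms with a double root is needed. Given values
  \<open>c\<^sub>k\<close> with \<open>c\<^sub>0 = c\<^sub>1 = 0\<close> and \<open>c\<^sub>n \<noteq> 0\<close>, factoring \<open>\<Sum> c\<^sub>k z^k\<close> over the complex numbers yields
  a pencil with this determinant whose tensor is tangent to the Segre variety at a coordinate point.
  All points of the Segre variety are smooth, so the hyperdeterminant vanishes at the tensor and
  \<open>\<Phi>\<close> vanishes at \<open>c\<close>. Therefore setting \<open>U\<^sub>0 = U\<^sub>1 = 0\<close> kills \<open>\<Phi>\<close>: every monomial of \<open>\<Phi>\<close>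
  contains \<open>U\<^sub>0\<close> or \<open>U\<^sub>1\<close>.\<close>

section \<open>Evaluation of polynomials\<close>

definition eval_monomial :: "('v \<Rightarrow> complex) \<Rightarrow> 'v monomial \<Rightarrow> complex" where
  "eval_monomial a m = (\<Prod>v\<in>supp m. a v ^ expo m v)"

lemma finite_supp [simp]: "finite (supp m)"
  by (simp add: supp_def)

lemma finite_monomials [simp]: "finite (monomials p)"
  by (simp add: monomials_def)

text \<open>Indeterminates outside the support contribute a factor \<open>x ^ 0 = 1\<close>, so
  several monomials can be evaluated over one common index set.\<close>

lemma eval_monomial_superset:
  assumes "finite A" "supp m \<subseteq> A"
  shows "eval_monomial a m = (\<Prod>v\<in>A. a v ^ expo m v)"
  unfolding eval_monomial_def
  using assms by (intro prod.mono_neutral_left) (auto simp: supp_def in_keys_iff)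

lemma eval_monomial_0 [simp]: "eval_monomial a 0 = 1"
  by (simp add: eval_monomial_def supp_def)

lemma eval_monomial_single [simp]: "eval_monomial a (Poly_Mapping.single v e) = a v ^ e"
  by (simp add: eval_monomial_def supp_def)

lemma eval_monomial_add: "eval_monomial a (m + m') = eval_monomial a m * eval_monomial a m'"
proof -
  have "supp (m + m') \<subseteq> supp m \<union> supp m'"
    unfolding supp_def by (rule keys_add)
  then show ?thesis
    by (subst (1 2 3) eval_monomial_superset[of "supp m \<union> supp m'"])
      (auto simp: lookup_add power_add prod.distrib)
qed

lemma eval_poly_superset:
  assumes "finite M" "monomials p \<subseteq> M"
  shows "eval_poly a p = (\<Sum>m\<in>M. coeff_of p m * eval_monomial a m)"
  unfolding eval_poly_def eval_monomial_def
  using assms by (intro sum.mono_neutral_left) (auto simp: monomials_def in_keys_iff)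

lemma eval_poly_0 [simp]: "eval_poly a 0 = 0"
  by (simp add: eval_poly_def monomials_def)

lemma eval_poly_single [simp]: "eval_poly a (Poly_Mapping.single m c) = c * eval_monomial a m"
  by (subst eval_poly_superset[of "{m}"]) (auto simp: monomials_def)

lemma eval_poly_1 [simp]: "eval_poly a 1 = 1"
  by (simp flip: single_one)

lemma eval_poly_Var [simp]: "eval_poly a (Var v) = a v"
  by (simp add: Var_def)

lemma eval_poly_Const [simp]: "eval_poly a (Const c) = c"
  by (simp add: Const_def)

lemma eval_poly_add: "eval_poly a (p + q) = eval_poly a p + eval_poly a q"
proof -
  have "monomials (p + q) \<subseteq> monomials p \<union> monomials q"
    unfolding monomials_def by (rule keys_add)
  then show ?thesis
    by (subst (1 2 3) eval_poly_superset[of "monomials p \<union> monomials q"])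
      (auto simp: lookup_add sum.distrib algebra_simps)
qed

lemma eval_poly_sum: "eval_poly a (\<Sum>x\<in>A. f x) = (\<Sum>x\<in>A. eval_poly a (f x))"
  by (induction A rule: infinite_finite_induct) (auto simp: eval_poly_add)

text \<open>Expanding into single terms reduces multiplicativity of evaluation to products of
  monomials.\<close>

lemma cpoly_decompose: "p = (\<Sum>m\<in>monomials p. Poly_Mapping.single m (coeff_of p m))"
  by (rule poly_mapping_eqI)
    (auto simp: lookup_sum lookup_single when_def monomials_def in_keys_iff)

lemma eval_poly_mult: "eval_poly a (p * q) = eval_poly a p * eval_poly a q"
proof -
  have "p * q = (\<Sum>m\<in>monomials p. Poly_Mapping.single m (coeff_of p m)) *
      (\<Sum>m\<in>monomials q. Poly_Mapping.single m (coeff_of q m))"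
    by (simp flip: cpoly_decompose)
  also have "eval_poly a \<dots> = (\<Sum>m\<in>monomials p. coeff_of p m * eval_monomial a m) *
      (\<Sum>m\<in>monomials q. coeff_of q m * eval_monomial a m)"
    by (simp add: sum_product eval_poly_sum mult_single eval_monomial_add mult_ac)
  finally show ?thesis
    by (simp add: eval_poly_superset[OF finite_monomials order_refl])
qed

text \<open>As a ring homomorphism, evaluation commutes with determinants of polynomial
  matrices.\<close>

global_interpretation eval_poly: comm_ring_hom "eval_poly a"
  by unfold_locales (simp_all add: eval_poly_add eval_poly_mult)

lemma eval_poly_power: "eval_poly a (p ^ k) = eval_poly a p ^ k"
  by (induction k) (simp_all add: eval_poly_mult)

lemma eval_poly_prod: "eval_poly a (\<Prod>x\<in>A. f x) = (\<Prod>x\<in>A. eval_poly a (f x))"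
  by (induction A rule: infinite_finite_induct) (auto simp: eval_poly_mult)

lemma eval_poly_diff: "eval_poly a (p - q) = eval_poly a p - eval_poly a q"
  by (metis diff_add_cancel add_diff_cancel_right' eval_poly_add)

lemma eval_poly_subst: "eval_poly a (subst_poly s p) = eval_poly (\<lambda>v. eval_poly a (s v)) p"
  by (simp add: subst_poly_def eval_poly_def[of _ p] eval_poly_sum eval_poly_mult eval_poly_prod
      eval_poly_power)

lemma eval_poly_cong_in:
  assumes "p \<in> polys_in I" "\<And>v. v \<in> I \<Longrightarrow> a v = b v"
  shows "eval_poly a p = eval_poly b p"
proof -
  have "a v = b v" if "m \<in> monomials p" "v \<in> supp m" for m v
    using assms that unfolding polys_in_def by blast
  then show ?thesis
    by (simp add: eval_poly_def)
qed

section \<open>Polynomials in a prescribed set of indeterminates\<close>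

lemma polys_in_iff: "p \<in> polys_in I \<longleftrightarrow> (\<forall>m\<in>Poly_Mapping.keys p. Poly_Mapping.keys m \<subseteq> I)"
  by (simp add: polys_in_def monomials_def supp_def)

lemma polys_in_0 [simp]: "0 \<in> polys_in I"
  by (simp add: polys_in_iff)

lemma polys_in_1 [simp]: "1 \<in> polys_in I"
  by (simp add: polys_in_iff)

lemma polys_in_Var [simp]: "v \<in> I \<Longrightarrow> Var v \<in> polys_in I"
  by (simp add: polys_in_iff Var_def)

lemma polys_in_add: "p \<in> polys_in I \<Longrightarrow> q \<in> polys_in I \<Longrightarrow> p + q \<in> polys_in I"
  unfolding polys_in_iff using keys_add[of p q] by blast

lemma polys_in_minus: "p \<in> polys_in I \<Longrightarrow> - p \<in> polys_in I"
  by (simp add: polys_in_iff)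

lemma polys_in_diff: "p \<in> polys_in I \<Longrightarrow> q \<in> polys_in I \<Longrightarrow> p - q \<in> polys_in I"
  unfolding polys_in_iff using keys_diff[of p q] by blast

lemma polys_in_mult:
  assumes "p \<in> polys_in I" "q \<in> polys_in I"
  shows "p * q \<in> polys_in I"
  unfolding polys_in_iff
proof
  fix m assume "m \<in> Poly_Mapping.keys (p * q)"
  then obtain m1 m2 where "m = m1 + m2" "m1 \<in> Poly_Mapping.keys p" "m2 \<in> Poly_Mapping.keys q"
    using keys_mult[of p q] by blast
  then show "Poly_Mapping.keys m \<subseteq> I"
    using assms keys_add[of m1 m2] unfolding polys_in_iff by blast
qed

lemma polys_in_sum: "(\<And>x. x \<in> A \<Longrightarrow> f x \<in> polys_in I) \<Longrightarrow> (\<Sum>x\<in>A. f x) \<in> polys_in I"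
  by (induction A rule: infinite_finite_induct) (auto simp: polys_in_add)

lemma polys_in_prod: "(\<And>x. x \<in> A \<Longrightarrow> f x \<in> polys_in I) \<Longrightarrow> (\<Prod>x\<in>A. f x) \<in> polys_in I"
  by (induction A rule: infinite_finite_induct) (auto simp: polys_in_mult)

lemma polys_in_det:
  assumes "A \<in> carrier_mat n n" "\<And>i j. i < n \<Longrightarrow> j < n \<Longrightarrow> A $$ (i, j) \<in> polys_in I"
  shows "det A \<in> polys_in I"
  unfolding det_def'[OF assms(1)]
proof (intro polys_in_sum polys_in_mult polys_in_prod)
  fix p assume "p \<in> {p. p permutes {0..<n}}"
  show "(signof p :: 'a cpoly) \<in> polys_in I"
    by (auto simp: sign_def intro: polys_in_minus)
next
  fix p i assume "p \<in> {p. p permutes {0..<n}}" "i \<in> {0..<n}"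
  then show "A $$ (i, p i) \<in> polys_in I"
    using permutes_in_image[of p "{0..<n}" i] by (intro assms) auto
qed

text \<open>By the product rule the directional derivative is the gradient at \<open>u\<close>
  paired with \<open>w\<close>. Choosing \<open>g\<close> before \<open>w\<close> records that it is
  linear in \<open>w\<close>.\<close>

lemma eval_poly_line_deriv:
  "\<exists>g. \<forall>w. ((\<lambda>t. eval_poly (\<lambda>i. u i + t * w i) F) has_field_derivative
      (\<Sum>v\<in>(\<Union>m\<in>monomials F. supp m). g v * w v)) (at 0)"
proof -
  let ?V = "\<Union>m\<in>monomials F. supp m"
  \<comment> \<open>\<open>h m v\<close> is the partial derivative at \<open>u\<close> of the term
    of \<open>F\<close> with monomial \<open>m\<close>; its value 0 off the support allows summation
    over all of \<open>?V\<close>.\<close>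
  define h where "h m v = (if v \<in> supp m
    then coeff_of F m * (of_nat (expo m v) * u v ^ (expo m v - 1) *
      (\<Prod>y\<in>supp m - {v}. u y ^ expo m y)) else 0)" for m v
  have "((\<lambda>t. eval_poly (\<lambda>i. u i + t * w i) F) has_field_derivative
      (\<Sum>v\<in>?V. (\<Sum>m\<in>monomials F. h m v) * w v)) (at 0)" for w
  proof -
    have 1: "(\<Sum>v\<in>?V. (\<Sum>m\<in>monomials F. h m v) * w v)
       = (\<Sum>m\<in>monomials F. coeff_of F m *
        (\<Sum>v\<in>supp m. of_nat (expo m v) * u v ^ (expo m v - 1) * w v *
      (\<Prod>y\<in>supp m - {v}. (u y + 0 * w y) ^ expo m y)))"
      unfolding sum_distrib_right
    proof (subst sum.swap, intro sum.cong refl)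
      fix m assume m: "m \<in> monomials F"
      have "(\<Sum>v\<in>?V. h m v * w v) = (\<Sum>v\<in>supp m. h m v * w v)"
        using m by (intro sum.mono_neutral_right) (auto simp: h_def)
      then show "(\<Sum>v\<in>?V. h m v * w v) = coeff_of F m *
        (\<Sum>v\<in>supp m. of_nat (expo m v) * u v ^ (expo m v - 1) * w v *
        (\<Prod>y\<in>supp m - {v}. (u y + 0 * w y) ^ expo m y))"
        by (simp add: h_def sum_distrib_left mult_ac)
    qed
    show ?thesis
      unfolding eval_poly_def 1
      by (intro DERIV_sum DERIV_cmult has_field_derivative_prod)
        (auto intro!: derivative_eq_intros)
  qed
  then show ?thesis
    by (intro exI[of _ "\<lambda>v. \<Sum>m\<in>monomials F. h m v"] allI)
qed

section \<open>Tangent spaces of Segre varieties\<close>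

text \<open>The scaling is the one in \<open>cdimension\<close>, so that \<open>cfun.dim\<close> is
  the dimension measured there.\<close>

global_interpretation cfun: vector_space "\<lambda>(c::complex) (w :: 'a \<Rightarrow> complex) i. c * w i"
  by unfold_locales (auto simp: fun_eq_iff algebra_simps)

lemma sum_fun_apply: "(\<Sum>x\<in>A. f x) i = (\<Sum>x\<in>A. f x i :: complex)"
  by (induction A rule: infinite_finite_induct) auto

definition std_vec :: "'v \<Rightarrow> 'v \<Rightarrow> complex" where
  "std_vec i = (\<lambda>j. if j = i then 1 else 0)"

lemma std_vec_simps [simp]: "std_vec i i = 1" "i \<noteq> j \<Longrightarrow> std_vec i j = 0"
  by (auto simp: std_vec_def)

lemma vecs_subset_span:
  assumes "finite S"
  shows "vecs S \<subseteq> cfun.span (std_vec ` S)"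
proof
  fix w :: "'a \<Rightarrow> complex" assume w: "w \<in> vecs S"
  have "(\<Sum>i\<in>S. (\<lambda>j. w i * std_vec i j)) = w"
  proof
    fix j
    have "(\<Sum>i\<in>S. (\<lambda>j. w i * std_vec i j)) j = (\<Sum>i\<in>S. if i = j then w j else 0)"
      unfolding sum_fun_apply by (intro sum.cong) (auto simp: std_vec_def)
    also have "\<dots> = w j"
      using assms w by (simp add: vecs_def)
    finally show "(\<Sum>i\<in>S. (\<lambda>j. w i * std_vec i j)) j = w j" .
  qed
  moreover have "(\<Sum>i\<in>S. (\<lambda>j. w i * std_vec i j)) \<in> cfun.span (std_vec ` S)"
    by (intro cfun.span_sum cfun.span_scale cfun.span_base imageI)
  ultimately show "w \<in> cfun.span (std_vec ` S)"
    by simp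
qed

lemma cdimension_le_card:
  assumes "finite S" "W \<subseteq> vecs S"
  shows "cdimension W \<le> card S"
proof -
  have "cdimension W \<le> card (std_vec ` S)"
    unfolding cdimension_def
    using assms vecs_subset_span[of S] by (intro cfun.dim_le_card) auto
  also have "\<dots> \<le> card S"
    by (rule card_image_le[OF assms(1)])
  finally show ?thesis .
qed

text \<open>Restricted to the coordinates in \<open>S\<close>, the vectors \<open>b i\<close> become
  the standard basis, hence they are linearly independent whatever their other entries are.\<close>

lemma card_le_cdimension:
  assumes "finite I" "W \<subseteq> vecs I" "finite S" "\<And>i. i \<in> S \<Longrightarrow> b i \<in> W"
    and b: "\<And>i j. i \<in> S \<Longrightarrow> j \<in> S \<Longrightarrow> b i j = std_vec i j"
  shows "card S \<le> cdimension W"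
proof -
  have inj: "inj_on b S"
    by (rule inj_onI) (metis b std_vec_def zero_neq_one)
  have indep: "cfun.independent (b ` S)"
  proof (rule cfun.independent_if_scalars_zero)
    fix f v assume f: "(\<Sum>x\<in>b ` S. (\<lambda>i. f x * x i)) = 0" and "v \<in> b ` S"
    then obtain j where j: "j \<in> S" "v = b j" by auto
    have "0 = (\<Sum>x\<in>b ` S. (\<lambda>i. f x * x i)) j"
      using f by simp
    also have "\<dots> = (\<Sum>i\<in>S. f (b i) * b i j)"
      by (simp add: sum_fun_apply sum.reindex[OF inj])
    also have "\<dots> = (\<Sum>i\<in>S. if i = j then f (b j) else 0)"
      using j b by (intro sum.cong) (auto simp: std_vec_def)
    also have "\<dots> = f v"
      using assms j by simp
    finally show "f v = 0" by simp
  qed (use assms in auto)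
  obtain B where B: "B \<subseteq> W" "cfun.independent B" "W \<subseteq> cfun.span B" "card B = cfun.dim W"
    by (rule cfun.basis_exists)
  \<comment> \<open>Finiteness matters because \<open>card\<close> is 0 on infinite sets; it comes
    from the finite spanning set of \<open>vecs I\<close>.\<close>
  have "finite B"
    using cfun.independent_span_bound[of "std_vec ` I" B] vecs_subset_span[of I] assms B by auto
  then have "card (b ` S) \<le> card B"
    using cfun.independent_span_bound[OF _ indep] assms B(3) by blast
  then show ?thesis
    by (simp add: card_image[OF inj] B(4) cdimension_def)
qed

text \<open>Every defining condition is the vanishing of a linear form in \<open>w\<close>, with
  coefficients depending only on \<open>u\<close> and \<open>F\<close>.\<close>

lemma subspace_tangent_space: "cfun.subspace (tangent_space I V p)"
proof -
  have "\<exists>g. \<forall>w. deriv (\<lambda>t. eval_poly (\<lambda>i. u i + t * w i) F) 0 =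
      (\<Sum>v\<in>(\<Union>m\<in>monomials F. supp m). g v * w v)"
    for u and F :: "'a cpoly"
    using eval_poly_line_deriv[of u F] by (auto dest!: DERIV_imp_deriv)
  then have "\<exists>g. \<forall>u F w. deriv (\<lambda>t. eval_poly (\<lambda>i. u i + t * w i) (F :: 'a cpoly)) 0 =
      (\<Sum>v\<in>(\<Union>m\<in>monomials F. supp m). g u F v * w v)"
    by (intro choice allI)
  then obtain g where *: "\<And>u w F. deriv (\<lambda>t. eval_poly (\<lambda>i. u i + t * w i) (F :: 'a cpoly)) 0 =
      (\<Sum>v\<in>(\<Union>m\<in>monomials F. supp m). g u F v * w v)"
    by blast
  show ?thesis
    unfolding tangent_space_def *
    by (rule cfun.subspaceI)
      (auto simp: vecs_def distrib_left sum.distrib mult.left_commute[of "g _ _ _"]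
        simp flip: sum_distrib_left)
qed

section \<open>The Segre map and curves on the Segre variety\<close>

lemma finite_multi_indices [simp]: "finite (multi_indices l)"
proof (rule finite_subset)
  show "multi_indices l \<subseteq> {is. set is \<subseteq> {..sum_list l + 1} \<and> length is = length l}"
  proof
    fix "is" assume "is \<in> multi_indices l"
    then show "is \<in> {is. set is \<subseteq> {..sum_list l + 1} \<and> length is = length l}"
      using elem_le_sum_list[of _ l] unfolding multi_indices_def
      by (force simp: in_set_conv_nth intro: order.trans)
  qed
qed (simp add: finite_lists_length_eq)

lemma proj_point_self: "a \<in> proj_point a"
  by (auto simp: proj_point_def intro: exI[of _ 1])

lemma proj_point_scale:
  assumes "c \<noteq> 0"
  shows "proj_point (\<lambda>i. c * a i) = proj_point a"
proof -
  have "\<exists>e. (\<lambda>i. d * a i) = (\<lambda>i. e * (c * a i)) \<and> e \<noteq> 0" if "d \<noteq> 0" for d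
    using assms that by (intro exI[of _ "d / c"]) auto
  moreover have "\<exists>e. (\<lambda>i. d * (c * a i)) = (\<lambda>i. e * a i) \<and> e \<noteq> 0" if "d \<noteq> 0" for d
    using assms that by (intro exI[of _ "d * c"]) auto
  ultimately show ?thesis
    unfolding proj_point_def by blast
qed

lemma segre_vec_in_vecs [simp]: "segre_vec l x \<in> vecs (multi_indices l)"
  by (simp add: segre_vec_def vecs_def)

text \<open>Each coordinate of the Segre map contains factor \<open>k\<close> exactly once, so the
  map is linear in that factor.\<close>

lemma segre_vec_linear:
  assumes "k < length l"
  shows "segre_vec l (x(k := (\<lambda>i. c * y i + t * z i))) is =
    c * segre_vec l (x(k := y)) is + t * segre_vec l (x(k := z)) is"
proof -
  have "(\<Prod>j<length l. (x(k := v)) j (is ! j)) = v (is ! k) * (\<Prod>j\<in>{..<length l} - {k}. x j (is ! j))"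
    for v
    using assms by (subst prod.remove[of _ k]) (auto intro!: prod.cong)
  then show ?thesis
    unfolding segre_vec_def by (simp add: algebra_simps)
qed

text \<open>The line through a point of the cone over the Segre variety that varies a single tensor
  factor stays in the cone.\<close>

lemma segre_vec_in_tangent_space:
  assumes x: "\<And>j. j < length l \<Longrightarrow> x j \<in> vecs {1..l ! j + 1} \<and> x j \<noteq> 0"
    and k: "k < length l" and y: "y \<in> vecs {1..l ! k + 1}"
  shows "segre_vec l (x(k := y)) \<in>
    tangent_space (multi_indices l) (segre_variety l) (proj_point (segre_vec l x))"
  unfolding tangent_space_def
proof (intro CollectI conjI ballI)
  fix F u
  assume F: "F \<in> vanishing_ideal (multi_indices l) (segre_variety l)"
    and "u \<in> proj_point (segre_vec l x)"
  then obtain c where u: "u = (\<lambda>i. c * segre_vec l x i)" and c: "c \<noteq> 0"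
    by (auto simp: proj_point_def)
  obtain i where i: "x k i \<noteq> 0"
    using x[OF k] by (auto simp: fun_eq_iff)
  \<comment> \<open>The moved point is a point of the Segre variety only while its
    \<open>k\<close>-th factor is nonzero; by continuity this holds for \<open>t\<close> near 0,
    which suffices for the derivative.\<close>
  have "((\<lambda>t. c * x k i + t * y i) \<longlongrightarrow> c * x k i + 0 * y i) (nhds 0)"
    by (intro tendsto_intros filterlim_ident)
  then have "\<forall>\<^sub>F t in nhds 0. c * x k i + t * y i \<noteq> 0"
    by (rule tendsto_imp_eventually_ne) (use c i in auto)
  then have "\<forall>\<^sub>F t in nhds 0. eval_poly (\<lambda>is. u is + t * segre_vec l (x(k := y)) is) F = 0"
  proof eventually_elim
    case (elim t)
    let ?z = "x(k := (\<lambda>i. c * x k i + t * y i))"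
    have "(\<lambda>is. u is + t * segre_vec l (x(k := y)) is) = segre_vec l ?z"
      using segre_vec_linear[OF k, of x c "x k" t y] by (auto simp: u)
    moreover have "?z j \<in> vecs {1..l ! j + 1} \<and> ?z j \<noteq> 0" if "j < length l" for j
      using x[OF that] y elim by (auto simp: vecs_def fun_eq_iff)
    then have "proj_point (segre_vec l ?z) \<in> segre_variety l"
      unfolding segre_variety_def by blast
    ultimately show ?case
      using F proj_point_self unfolding vanishing_ideal_def vanishes_at_def by force
  qed
  then have "deriv (\<lambda>t. eval_poly (\<lambda>is. u is + t * segre_vec l (x(k := y)) is) F) 0
      = deriv (\<lambda>_. 0) (0::complex)"
    by (intro deriv_cong_ev) auto
  then show "deriv (\<lambda>t. eval_poly (\<lambda>is. u is + t * segre_vec l (x(k := y)) is) F) 0 = 0"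
    by simp
qed simp

text \<open>Each factor has a nonzero coordinate, and dividing by it only rescales the product. The
  positions of these coordinates form \<alpha>.\<close>

lemma segre_variety_normalized:
  assumes "q \<in> segre_variety l"
  obtains x \<alpha> where "\<alpha> \<in> multi_indices l" "\<And>k. k < length l \<Longrightarrow> x k \<in> vecs {1..l ! k + 1}"
    "\<And>k. k < length l \<Longrightarrow> x k (\<alpha> ! k) = 1" "q = proj_point (segre_vec l x)"
proof -
  obtain x where q: "q = proj_point (segre_vec l x)"
    and x: "\<And>k. k < length l \<Longrightarrow> x k \<in> vecs {1..l ! k + 1} \<and> x k \<noteq> 0"
    using assms unfolding segre_variety_def by blast
  have "\<exists>i. x k i \<noteq> 0" if "k < length l" for k
    using x[OF that] by (auto simp: fun_eq_iff)
  then obtain f where f: "\<And>k. k < length l \<Longrightarrow> x k (f k) \<noteq> 0"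
    by metis
  define y where "y k i = x k i / x k (f k)" for k i
  let ?\<alpha> = "map f [0..<length l]" and ?c = "\<Prod>k<length l. x k (f k)"
  have "f k \<in> {1..l ! k + 1}" if "k < length l" for k
    using x[OF that] f[OF that] unfolding vecs_def by blast
  then have 1: "?\<alpha> \<in> multi_indices l"
    by (simp add: multi_indices_def)
  have "?c \<noteq> 0"
    using f by auto
  moreover have "?c * (\<Prod>k<length l. y k (is ! k)) = (\<Prod>k<length l. x k (is ! k))" for "is"
    unfolding prod.distrib[symmetric] using f by (intro prod.cong) (auto simp: y_def)
  then have "segre_vec l x = (\<lambda>is. ?c * segre_vec l y is)"
    by (auto simp: segre_vec_def)
  ultimately have "q = proj_point (segre_vec l y)"
    by (simp add: q proj_point_scale)
  moreover have "y k \<in> vecs {1..l ! k + 1}" "y k (?\<alpha> ! k) = 1" if "k < length l" for k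
    using x[OF that] f[OF that] that by (auto simp: y_def vecs_def)
  ultimately show ?thesis
    using 1 that by blast
qed

section \<open>Smoothness at the coordinate points\<close>

text \<open>These are the multi-indices at Hamming distance at most 1 from \<alpha>. For nonempty
  \<open>l\<close> they name the coordinate directions spanning the tangent space of the cone at
  \<open>std_vec \<alpha>\<close>.\<close>

definition neighbours :: "nat list \<Rightarrow> nat list \<Rightarrow> nat list set" where
  "neighbours l \<alpha> = {\<beta> \<in> multi_indices l. \<exists>k<length l. \<forall>j<length l. j \<noteq> k \<longrightarrow> \<beta> ! j = \<alpha> ! j}"

lemma finite_neighbours [simp]: "finite (neighbours l \<alpha>)"
  by (simp add: neighbours_def)

lemma multi_indices_eqI:
  "\<alpha> \<in> multi_indices l \<Longrightarrow> \<beta> \<in> multi_indices l \<Longrightarrow> (\<And>k. k < length l \<Longrightarrow> \<alpha> ! k = \<beta> ! k) \<Longrightarrow> \<alpha> = \<beta>"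
  by (auto simp: multi_indices_def intro: nth_equalityI)

text \<open>Interchanging the values \<open>\<alpha> ! k\<close> and \<open>\<alpha>' ! k\<close> in
  every place \<open>k\<close> maps neighbours of \<alpha> injectively to neighbours of
  \<open>\<alpha>'\<close>.\<close>

lemma card_neighbours_le:
  assumes "\<alpha> \<in> multi_indices l" "\<alpha>' \<in> multi_indices l"
  shows "card (neighbours l \<alpha>) \<le> card (neighbours l \<alpha>')"
proof (rule card_inj_on_le)
  let ?f = "\<lambda>\<beta>. map (\<lambda>k. Transposition.transpose (\<alpha> ! k) (\<alpha>' ! k) (\<beta> ! k)) [0..<length l]"
  show "inj_on ?f (neighbours l \<alpha>)"
    by (intro inj_onI multi_indices_eqI[of _ l])
      (auto simp: neighbours_def map_eq_conv dest: transpose_eq_imp_eq)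
  show "?f ` neighbours l \<alpha> \<subseteq> neighbours l \<alpha>'"
    using assms by (auto simp: neighbours_def multi_indices_def Transposition.transpose_def)
qed auto

lemma segre_vec_neighbour:
  assumes "\<gamma> \<in> multi_indices l" "k < length l" "\<And>j. j < length l \<Longrightarrow> j \<noteq> k \<Longrightarrow> \<gamma> ! j = \<alpha> ! j"
  shows "segre_vec l x \<gamma> = x k (\<gamma> ! k) * (\<Prod>j\<in>{..<length l} - {k}. x j (\<alpha> ! j))"
  unfolding segre_vec_def using assms
  by (simp add: prod.remove[of "{..<length l}" k])

text \<open>At a normalized point, replacing one factor by a standard basis vector gives tangent
  vectors. Suitable combinations of them restrict to the standard basis on the neighbours of
  \<open>\<alpha>'\<close>, which are at least as many as those of \<alpha>.\<close>

lemma card_neighbours_le_cdimension: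
  assumes \<alpha>: "\<alpha> \<in> multi_indices l" and q: "q \<in> segre_variety l"
  shows "card (neighbours l \<alpha>) \<le> cdimension (tangent_space (multi_indices l) (segre_variety l) q)"
    (is "_ \<le> cdimension ?T")
proof -
  obtain x \<alpha>' where \<alpha>': "\<alpha>' \<in> multi_indices l" and x: "\<And>k. k < length l \<Longrightarrow> x k \<in> vecs {1..l ! k + 1}"
    and x1: "\<And>k. k < length l \<Longrightarrow> x k (\<alpha>' ! k) = 1" and q: "q = proj_point (segre_vec l x)"
    using segre_variety_normalized[OF q] by blast
  have x0: "x k \<noteq> 0" if "k < length l" for k
    using x1[OF that] by auto
  let ?S = "neighbours l \<alpha>'" and ?d = "length l"
  have T: "segre_vec l (x(k := y)) \<in> ?T" if "k < ?d" "y \<in> vecs {1..l ! k + 1}" for k y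
    unfolding q using x x0 that by (intro segre_vec_in_tangent_space) auto
  have std: "std_vec (\<beta> ! k) \<in> vecs {1..l ! k + 1}" if "\<beta> \<in> multi_indices l" "k < ?d" for k \<beta>
    using that by (auto simp: std_vec_def vecs_def multi_indices_def)
  \<comment> \<open>Here \<gamma> deviates from \<open>\<alpha>'\<close> at most in place
    \<open>k'\<close>. By normalization every factor other than \<open>k\<close> and
    \<open>k'\<close> contributes 1.\<close>
  have val: "segre_vec l (x(k := v)) \<gamma> = (if k = k' then v (\<gamma> ! k') else v (\<alpha>' ! k) * x k' (\<gamma> ! k'))"
    if "\<gamma> \<in> multi_indices l" "k' < ?d" "\<And>j. j < ?d \<Longrightarrow> j \<noteq> k' \<Longrightarrow> \<gamma> ! j = \<alpha>' ! j" "k < ?d" for \<gamma> k k' v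
  proof -
    have "segre_vec l (x(k := v)) \<gamma> =
        (x(k := v)) k' (\<gamma> ! k') * (\<Prod>j\<in>{..<?d} - {k'}. (x(k := v)) j (\<alpha>' ! j))"
      by (rule segre_vec_neighbour[OF that(1,2,3)])
    also have "(\<Prod>j\<in>{..<?d} - {k'}. (x(k := v)) j (\<alpha>' ! j)) =
        (\<Prod>j\<in>{..<?d} - {k'}. if j = k then v (\<alpha>' ! k) else 1)"
      using x1 by (intro prod.cong) auto
    also have "\<dots> = (if k = k' then 1 else v (\<alpha>' ! k))"
      using that by simp
    finally have eq: "segre_vec l (x(k := v)) \<gamma> =
        (x(k := v)) k' (\<gamma> ! k') * (if k = k' then 1 else v (\<alpha>' ! k))" .
    show ?thesis
      unfolding eq by simp
  qed
  have "\<exists>b\<in>?T. \<forall>\<gamma>\<in>?S. b \<gamma> = std_vec \<beta> \<gamma>" if "\<beta> \<in> ?S" for \<beta>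
  proof (cases "\<beta> = \<alpha>'")
    case True
    have d: "?d > 0"
      using \<open>\<beta> \<in> ?S\<close> by (auto simp: neighbours_def)
    \<comment> \<open>At \<gamma> the summand for \<open>k = k'\<close> is the desired value, and
      each of the other \<open>?d - 1\<close> summands is \<open>x k' (\<gamma> ! k')\<close>, the
      value of \<open>segre_vec l x\<close>. The subtraction removes exactly these.\<close>
    let ?b = "(\<Sum>k<?d. segre_vec l (x(k := std_vec (\<alpha>' ! k)))) - (\<lambda>is. (of_nat ?d - 1) * segre_vec l x is)"
    have sx: "segre_vec l x \<in> ?T"
      using T[OF d x[OF d]] by simp
    have "?b \<in> ?T"
      using \<alpha>' by (intro cfun.subspace_diff cfun.subspace_sum cfun.subspace_scale subspace_tangent_space
          sx T std) auto
    moreover have "?b \<gamma> = std_vec \<beta> \<gamma>" if "\<gamma> \<in> ?S" for \<gamma>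
    proof -
      obtain k' where k': "\<gamma> \<in> multi_indices l" "k' < ?d" "\<And>j. j < ?d \<Longrightarrow> j \<noteq> k' \<Longrightarrow> \<gamma> ! j = \<alpha>' ! j"
        using \<open>\<gamma> \<in> ?S\<close> by (auto simp: neighbours_def)
      have eq: "\<gamma> = \<alpha>' \<longleftrightarrow> \<gamma> ! k' = \<alpha>' ! k'"
        using multi_indices_eqI[OF k'(1) \<alpha>'] k' by metis
      have 1: "segre_vec l x \<gamma> = x k' (\<gamma> ! k')"
        using val[OF k' k'(2), of "x k'"] by simp
      have "?b \<gamma> = (\<Sum>k<?d. segre_vec l (x(k := std_vec (\<alpha>' ! k))) \<gamma>) - (of_nat ?d - 1) * x k' (\<gamma> ! k')"
        by (simp add: sum_fun_apply 1)
      also have "(\<Sum>k<?d. segre_vec l (x(k := std_vec (\<alpha>' ! k))) \<gamma>) =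
          (\<Sum>k<?d. if k = k' then std_vec (\<alpha>' ! k') (\<gamma> ! k') else x k' (\<gamma> ! k'))"
        using val[OF k'] by (intro sum.cong) auto
      also have "\<dots> = std_vec (\<alpha>' ! k') (\<gamma> ! k') + (of_nat ?d - 1) * x k' (\<gamma> ! k')"
        using k'(2) by (simp add: sum.remove[of _ k'] of_nat_diff)
      finally have b: "?b \<gamma> = std_vec (\<alpha>' ! k') (\<gamma> ! k') + (of_nat ?d - 1) * x k' (\<gamma> ! k') -
          (of_nat ?d - 1) * x k' (\<gamma> ! k')" .
      show ?thesis
        unfolding b using eq True by (simp add: std_vec_def)
    qed
    ultimately show ?thesis by blast
  next
    case False
    obtain k where k: "\<beta> \<in> multi_indices l" "k < ?d" "\<And>j. j < ?d \<Longrightarrow> j \<noteq> k \<Longrightarrow> \<beta> ! j = \<alpha>' ! j"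
      using \<open>\<beta> \<in> ?S\<close> by (auto simp: neighbours_def)
    have neq: "\<beta> ! k \<noteq> \<alpha>' ! k"
      using multi_indices_eqI[OF k(1) \<alpha>'] k False by metis
    \<comment> \<open>No correction arises here: if \<gamma> deviates in another place, the new
      factor is evaluated at \<open>\<alpha>' ! k\<close>, where it is 0.\<close>
    let ?b = "segre_vec l (x(k := std_vec (\<beta> ! k)))"
    have "?b \<in> ?T"
      using k by (intro T std)
    moreover have "?b \<gamma> = std_vec \<beta> \<gamma>" if "\<gamma> \<in> ?S" for \<gamma>
    proof -
      obtain k' where k': "\<gamma> \<in> multi_indices l" "k' < ?d" "\<And>j. j < ?d \<Longrightarrow> j \<noteq> k' \<Longrightarrow> \<gamma> ! j = \<alpha>' ! j"
        using \<open>\<gamma> \<in> ?S\<close> by (auto simp: neighbours_def)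
      have "\<gamma> = \<beta> \<longleftrightarrow> k = k' \<and> \<gamma> ! k = \<beta> ! k"
        using multi_indices_eqI[OF k'(1) k(1)] k k' neq by metis
      then show ?thesis
        using val[OF k' k(2)] neq by (auto simp: std_vec_def)
    qed
    ultimately show ?thesis by blast
  qed
  then obtain b where b: "\<And>\<beta>. \<beta> \<in> ?S \<Longrightarrow> b \<beta> \<in> ?T"
    "\<And>\<beta> \<gamma>. \<beta> \<in> ?S \<Longrightarrow> \<gamma> \<in> ?S \<Longrightarrow> b \<beta> \<gamma> = std_vec \<beta> \<gamma>"
    by metis
  have "card (neighbours l \<alpha>) \<le> card ?S"
    by (rule card_neighbours_le[OF \<alpha> \<alpha>'])
  also have "\<dots> \<le> cdimension ?T"
    using b by (intro card_le_cdimension[of "multi_indices l" _ _ b]) (auto simp: tangent_space_def)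
  finally show ?thesis .
qed

lemma segre_vec_std:
  assumes "\<alpha> \<in> multi_indices l"
  shows "segre_vec l (\<lambda>k. std_vec (\<alpha> ! k)) = std_vec \<alpha>"
proof
  fix \<beta>
  show "segre_vec l (\<lambda>k. std_vec (\<alpha> ! k)) \<beta> = std_vec \<alpha> \<beta>"
  proof (cases "\<beta> \<in> multi_indices l")
    case True
    show ?thesis
    proof (cases "\<beta> = \<alpha>")
      case False
      then obtain k where "k < length l" "\<beta> ! k \<noteq> \<alpha> ! k"
        using multi_indices_eqI[OF True assms] by blast
      then show ?thesis
        using True False by (auto simp: segre_vec_def std_vec_def)
    qed (use True in \<open>simp add: segre_vec_def\<close>)
  qed (use assms in \<open>auto simp: segre_vec_def std_vec_def\<close>)
qed

lemma proj_point_std_vec_in_segre_variety: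
  assumes "\<alpha> \<in> multi_indices l"
  shows "proj_point (std_vec \<alpha>) \<in> segre_variety l"
  unfolding segre_variety_def segre_vec_std[OF assms, symmetric]
  using assms
  by (intro CollectI exI[of _ "\<lambda>k. std_vec (\<alpha> ! k)"])
    (auto simp: multi_indices_def vecs_def std_vec_def fun_eq_iff)

text \<open>Differentiating the two-by-two minors of a flattening at a coordinate point kills every
  coordinate whose index differs in at least two places.\<close>

lemma tangent_space_std_vec_subset:
  assumes \<alpha>: "\<alpha> \<in> multi_indices l" and d: "length l > 0"
  shows "tangent_space (multi_indices l) (segre_variety l) (proj_point (std_vec \<alpha>))
    \<subseteq> vecs (neighbours l \<alpha>)"
proof
  fix w assume w: "w \<in> tangent_space (multi_indices l) (segre_variety l) (proj_point (std_vec \<alpha>))"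
  have "w \<beta> = 0" if "\<beta> \<notin> neighbours l \<alpha>" for \<beta>
  proof (cases "\<beta> \<in> multi_indices l")
    case False
    then show ?thesis
      using w by (auto simp: tangent_space_def vecs_def)
  next
    case \<beta>: True
    have far: "\<exists>j<length l. j \<noteq> k \<and> \<beta> ! j \<noteq> \<alpha> ! j" if "k < length l" for k
      using \<open>\<beta> \<notin> neighbours l \<alpha>\<close> \<beta> that by (auto simp: neighbours_def)
    obtain k where k: "k < length l" "\<beta> ! k \<noteq> \<alpha> ! k"
      using far[OF d] by auto
    obtain j where j: "j < length l" "j \<noteq> k" "\<beta> ! j \<noteq> \<alpha> ! j"
      using far[OF k(1)] by auto
    \<comment> \<open>Exchanging the \<open>k\<close>-th entries of \<alpha> and \<beta> yields
      \<gamma> and \<delta>, which gives the minor \<open>F\<close>. The second deviation, in place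
      \<open>j\<close>, keeps \<delta> different from \<alpha>.\<close>
    define \<gamma> where "\<gamma> = \<alpha>[k := \<beta> ! k]"
    define \<delta> where "\<delta> = \<beta>[k := \<alpha> ! k]"
    have len: "length \<alpha> = length l" "length \<beta> = length l"
      using \<alpha> \<beta> by (auto simp: multi_indices_def)
    have mem: "\<gamma> \<in> multi_indices l" "\<delta> \<in> multi_indices l"
      using \<alpha> \<beta> k(1) by (auto simp: multi_indices_def \<gamma>_def \<delta>_def nth_list_update)
    have "\<gamma> ! k \<noteq> \<alpha> ! k" "\<delta> ! j \<noteq> \<alpha> ! j"
      using k j len by (simp_all add: \<gamma>_def \<delta>_def)
    then have neq: "\<gamma> \<noteq> \<alpha>" "\<delta> \<noteq> \<alpha>" "\<beta> \<noteq> \<alpha>"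
      using k by auto
    define F :: "nat list cpoly" where "F = Var \<alpha> * Var \<beta> - Var \<gamma> * Var \<delta>"
    have eval_F: "eval_poly a F = a \<alpha> * a \<beta> - a \<gamma> * a \<delta>" for a
      by (simp add: F_def eval_poly_diff eval_poly_mult)
    have minor: "segre_vec l x \<alpha> * segre_vec l x \<beta> = segre_vec l x \<gamma> * segre_vec l x \<delta>" for x
    proof -
      have "(\<Prod>i<length l. x i (\<alpha> ! i) * x i (\<beta> ! i)) = (\<Prod>i<length l. x i (\<gamma> ! i) * x i (\<delta> ! i))"
        using len k(1) by (intro prod.cong) (auto simp: \<gamma>_def \<delta>_def nth_list_update)
      then show ?thesis
        using \<alpha> \<beta> mem by (simp add: segre_vec_def prod.distrib)
    qed
    have "eval_poly u F = 0" if u: "u \<in> q" "q \<in> segre_variety l" for u q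
    proof -
      obtain c x where "u = (\<lambda>i. c * segre_vec l x i)"
        using u unfolding segre_variety_def proj_point_def by blast
      then show ?thesis
        using minor[of x] by (simp add: eval_F algebra_simps)
    qed
    then have "F \<in> vanishing_ideal (multi_indices l) (segre_variety l)"
      unfolding vanishing_ideal_def vanishes_at_def F_def
      using \<alpha> \<beta> mem by (auto intro!: polys_in_diff polys_in_mult)
    then have 0: "deriv (\<lambda>t. eval_poly (\<lambda>i. std_vec \<alpha> i + t * w i) F) 0 = 0"
      using w proj_point_self[of "std_vec \<alpha>"] by (simp add: tangent_space_def)
    \<comment> \<open>Only coordinate \<alpha> is nonzero at the point, so the product for \<gamma>
      and \<delta> vanishes to second order and the other product contributes
      \<open>w \<beta>\<close>.\<close>
    have "((\<lambda>t. eval_poly (\<lambda>i. std_vec \<alpha> i + t * w i) F) has_field_derivative w \<beta>) (at 0)"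
      unfolding eval_F using neq by (auto intro!: derivative_eq_intros simp: std_vec_def)
    then show ?thesis
      using 0 by (simp add: DERIV_imp_deriv)
  qed
  then show "w \<in> vecs (neighbours l \<alpha>)"
    by (auto simp: vecs_def)
qed

text \<open>The number of neighbours bounds the tangent dimension from above at this point and from
  below at every point, so the dimension is minimal here.\<close>

lemma proj_point_std_vec_smooth:
  assumes "\<alpha> \<in> multi_indices l" "length l > 0"
  shows "proj_point (std_vec \<alpha>) \<in> smooth_points (multi_indices l) (segre_variety l)"
  unfolding smooth_points_def
proof (intro CollectI conjI ballI)
  fix q assume "q \<in> segre_variety l"
  then show "cdimension (tangent_space (multi_indices l) (segre_variety l) (proj_point (std_vec \<alpha>)))
    \<le> cdimension (tangent_space (multi_indices l) (segre_variety l) q)"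
    using cdimension_le_card[OF finite_neighbours tangent_space_std_vec_subset[OF assms]]
      card_neighbours_le_cdimension[OF assms(1)] by (meson order.trans)
qed (rule proj_point_std_vec_in_segre_variety[OF assms(1)])

text \<open>A form without coefficients on the neighbours of \<alpha> annihilates the tangent space
  at a smooth point. Its hyperplane is therefore in the dual variety, the zero locus of
  \<open>H\<close>.\<close>

lemma hyperdeterminant_eval_0:
  assumes H: "is_hyperdeterminant l H" and \<alpha>: "\<alpha> \<in> multi_indices l" and d: "length l > 0"
    and a: "a \<in> vecs (multi_indices l)" "a \<noteq> 0" and 0: "\<And>\<beta>. \<beta> \<in> neighbours l \<alpha> \<Longrightarrow> a \<beta> = 0"
  shows "eval_poly a H = 0"
proof -
  let ?I = "multi_indices l"
  let ?V = "segre_variety l"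
  let ?p = "proj_point (std_vec \<alpha>)"
  have "a \<beta> * w \<beta> = 0" if "w \<in> vecs (neighbours l \<alpha>)" for w \<beta>
    using 0[of \<beta>] that by (cases "\<beta> \<in> neighbours l \<alpha>") (auto simp: vecs_def)
  then have "tangent_space ?I ?V ?p \<subseteq> hyperplane ?I a"
    using tangent_space_std_vec_subset[OF \<alpha> d]
    by (auto simp: hyperplane_def tangent_space_def intro!: sum.neutral)
  \<comment> \<open>Tangent hyperplanes lie in the dual variety because a set is contained in its
    Zariski closure.\<close>
  then have "proj_point a \<in> dual_variety ?I ?V"
    using a proj_point_std_vec_smooth[OF \<alpha> d]
    unfolding dual_variety_def zariski_closure_def zero_locus_def vanishing_ideal_def proj_space_def
    by blast
  moreover have "dual_variety ?I ?V = zero_locus ?I {H}"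
    using H by (simp add: is_hyperdeterminant_def is_defining_polynomial_def)
  ultimately show ?thesis
    using proj_point_self[of a] by (auto simp: zero_locus_def vanishes_at_def)
qed

section \<open>Nonvanishing and leading monomials\<close>

text \<open>Multiplying both polynomials by the indeterminate makes them agree at 0 as well.\<close>

lemma poly_eq_if_eq_nonzero:
  fixes p q :: "complex poly"
  assumes "\<And>z. z \<noteq> 0 \<Longrightarrow> poly p z = poly q z"
  shows "p = q"
proof -
  have "poly (pCons 0 p) = poly (pCons 0 q)"
    using assms by (auto simp: fun_eq_iff)
  then show ?thesis
    by (simp add: poly_eq_poly_eq_iff)
qed

text \<open>Reduction modulo \<open>N\<close> recovers digit 0, and removing it leaves shorter
  expansions for the induction.\<close>

lemma base_expansion_inject:
  fixes a b :: "nat \<Rightarrow> nat"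
  assumes "\<And>k. a k < N" "\<And>k. b k < N"
    and "(\<Sum>k\<le>n. a k * N ^ k) = (\<Sum>k\<le>n. b k * N ^ k)"
  shows "\<forall>k\<le>n. a k = b k"
  using assms
proof (induction n arbitrary: a b)
  case 0
  then show ?case by simp
next
  case (Suc n)
  have shift: "(\<Sum>k\<le>Suc n. c k * N ^ k) = c 0 + N * (\<Sum>k\<le>n. c (Suc k) * N ^ k)" for c :: "nat \<Rightarrow> nat"
    by (subst sum.atMost_Suc_shift) (simp add: sum_distrib_left mult_ac)
  have eq: "a 0 + N * (\<Sum>k\<le>n. a (Suc k) * N ^ k) = b 0 + N * (\<Sum>k\<le>n. b (Suc k) * N ^ k)"
    using Suc.prems(3) unfolding shift .
  have "a 0 = (a 0 + N * (\<Sum>k\<le>n. a (Suc k) * N ^ k)) mod N"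
    using Suc.prems(1) by simp
  also have "\<dots> = b 0"
    unfolding eq using Suc.prems(2) by simp
  finally have 0: "a 0 = b 0" .
  moreover have "N > 0"
    using Suc.prems(1)[of 0] by simp
  ultimately have "(\<Sum>k\<le>n. a (Suc k) * N ^ k) = (\<Sum>k\<le>n. b (Suc k) * N ^ k)"
    using eq by simp
  then have "\<forall>k\<le>n. a (Suc k) = b (Suc k)"
    using Suc.prems by (intro Suc.IH) auto
  then show ?case
    using 0 by (metis Suc_le_mono not0_implies_Suc)
qed

text \<open>Kronecker's substitution of \<open>z ^ N ^ k\<close> for the \<open>k\<close>-th variable separates the monomials.\<close>

lemma eval_poly_nonzero:
  fixes p :: "nat cpoly"
  assumes "p \<in> polys_in {..n}" "p \<noteq> 0"
  obtains a where "\<And>k. a k \<noteq> 0" "eval_poly a p \<noteq> 0"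
proof -
  let ?M = "monomials p"
  have supp: "supp m \<subseteq> {..n}" if "m \<in> ?M" for m
    using assms(1) that by (simp add: polys_in_def)
  \<comment> \<open>\<open>N\<close> exceeds all exponents in \<open>p\<close>, so the exponents of
    a monomial \<open>m\<close> are the base \<open>N\<close> digits of \<open>w m\<close>.\<close>
  define N where "N = Suc (\<Sum>m\<in>?M. \<Sum>k\<le>n. expo m k)"
  define w where "w m = (\<Sum>k\<le>n. expo m k * N ^ k)" for m :: "nat monomial"
  have expo_less: "expo m k < N" if m: "m \<in> ?M" for m k
  proof (cases "k \<le> n")
    case True
    have "expo m k \<le> (\<Sum>k\<le>n. expo m k)"
      using True by (intro member_le_sum) auto
    also have "\<dots> \<le> (\<Sum>m\<in>?M. \<Sum>k\<le>n. expo m k)"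
      using m by (intro member_le_sum) auto
    finally show ?thesis
      by (simp add: N_def)
  next
    case False
    then have "expo m k = 0"
      using supp[OF m] unfolding supp_def by (meson atMost_iff in_keys_iff subsetD)
    then show ?thesis
      by (simp add: N_def)
  qed
  have inj: "inj_on w ?M"
  proof (rule inj_onI)
    fix m m' assume m: "m \<in> ?M" "m' \<in> ?M" "w m = w m'"
    then have le: "\<forall>k\<le>n. expo m k = expo m' k"
      using expo_less by (intro base_expansion_inject[of _ N]) (auto simp: w_def)
    show "m = m'"
    proof (rule poly_mapping_eqI)
      fix k
      have "expo m k = 0 \<and> expo m' k = 0" if "\<not> k \<le> n"
        using supp[OF m(1)] supp[OF m(2)] that unfolding supp_def
        by (meson atMost_iff in_keys_iff subsetD)
      then show "expo m k = expo m' k"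
        using le by (cases "k \<le> n") auto
    qed
  qed
  define P where "P = (\<Sum>m\<in>?M. Polynomial.monom (coeff_of p m) (w m))"
  have eval: "eval_poly (\<lambda>k. z ^ N ^ k) p = poly P z" for z
  proof -
    have "eval_monomial (\<lambda>k. z ^ N ^ k) m = z ^ w m" if "m \<in> ?M" for m
      using supp[OF that]
      by (simp add: eval_monomial_superset[of "{..n}"] w_def power_sum mult.commute flip: power_mult)
    then show ?thesis
      by (simp add: eval_poly_superset[OF finite_monomials order_refl] P_def poly_sum poly_monom)
  qed
  have "?M \<noteq> {}"
    using assms(2) by (simp add: monomials_def)
  then obtain m where m: "m \<in> ?M" by blast
  have "Polynomial.coeff P (w m) = (\<Sum>m'\<in>?M. if m' = m then coeff_of p m else 0)"
    unfolding P_def coeff_sum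
    using inj m by (intro sum.cong) (auto simp: inj_on_def)
  also have "\<dots> \<noteq> 0"
    using m by (simp add: monomials_def in_keys_iff)
  finally have "P \<noteq> 0" by auto
  \<comment> \<open>Choosing \<open>z\<close> nonzero makes all coordinates \<open>z ^ N ^ k\<close>
    nonzero.\<close>
  then obtain z where "z \<noteq> 0" "poly P z \<noteq> 0"
    using poly_eq_if_eq_nonzero[of P 0] by auto
  then show ?thesis
    using that[of "\<lambda>k. z ^ N ^ k"] by (simp add: eval)
qed

section \<open>The degree reverse lexicographic order and leading monomials\<close>

lemma degrevlex_total: "a \<noteq> b \<Longrightarrow> degrevlex_less a b \<or> degrevlex_less b a"
proof -
  assume "a \<noteq> b"
  then have ex: "\<exists>k. expo a k \<noteq> expo b k"
    by (meson poly_mapping_eqI)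
  define k where "k = (LEAST k. expo a k \<noteq> expo b k)"
  have "expo a k \<noteq> expo b k" "\<forall>j<k. expo a j = expo b j"
    using LeastI_ex[OF ex] not_less_Least unfolding k_def by blast+
  then show ?thesis
    unfolding degrevlex_less_def by (metis linorder_neqE_nat)
qed

lemma degrevlex_trans: "degrevlex_less a b \<Longrightarrow> degrevlex_less b c \<Longrightarrow> degrevlex_less a c"
proof -
  assume ab: "degrevlex_less a b" and bc: "degrevlex_less b c"
  show ?thesis
  proof (cases "total_degree a = total_degree b \<and> total_degree b = total_degree c")
    case True
    then obtain j k where j: "expo a j > expo b j" "\<forall>i<j. expo a i = expo b i"
      and k: "expo b k > expo c k" "\<forall>i<k. expo b i = expo c i"
      using ab bc unfolding degrevlex_less_def by auto
    \<comment> \<open>The first difference between \<open>a\<close> and \<open>c\<close> is at the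
      smaller of the two places of first difference.\<close>
    have "expo a (min j k) > expo c (min j k)" "\<forall>i<min j k. expo a i = expo c i"
      using j k by (auto simp: min_def not_le) (metis le_neq_implies_less less_trans)
    then show ?thesis
      using True unfolding degrevlex_less_def by auto
  qed (use ab bc in \<open>auto simp: degrevlex_less_def\<close>)
qed

lemma degrevlex_irrefl: "\<not> degrevlex_less a a"
  by (simp add: degrevlex_less_def)

lemma degrevlex_maximum:
  assumes "finite A" "A \<noteq> {}"
  shows "\<exists>m\<in>A. \<forall>m'\<in>A. m' \<noteq> m \<longrightarrow> degrevlex_less m' m"
  using assms
proof (induction rule: finite_ne_induct)
  case (insert x A)
  then obtain m where "m \<in> A" "\<forall>m'\<in>A. m' \<noteq> m \<longrightarrow> degrevlex_less m' m" by blast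
  then show ?case
    using degrevlex_total[of x m] degrevlex_trans[of _ m x] by (metis insert_iff)
qed simp

text \<open>Existence and uniqueness of the maximum justify the definite description in
  \<open>lm\<close>. A statement about all monomials then applies to the leading one.\<close>

lemma lm_in_monomials:
  assumes "p \<noteq> 0"
  shows "lm p \<in> monomials p"
proof -
  obtain m where m: "m \<in> monomials p" "\<forall>m'\<in>monomials p. m' \<noteq> m \<longrightarrow> degrevlex_less m' m"
    using degrevlex_maximum[of "monomials p"] assms by (auto simp: monomials_def)
  have "lm p = m"
    unfolding lm_def
  proof (rule the_equality)
    fix m' assume m': "m' \<in> monomials p \<and> (\<forall>m''\<in>monomials p. m'' \<noteq> m' \<longrightarrow> degrevlex_less m'' m')"
    show "m' = m"
    proof (rule ccontr)
      assume "m' \<noteq> m"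
      then have "degrevlex_less m' m" "degrevlex_less m m'"
        using m m' by auto
      then show False
        using degrevlex_trans degrevlex_irrefl by blast
    qed
  qed (use m in blast)
  then show ?thesis
    using m by simp
qed

text \<open>Setting the indeterminates in \<open>B\<close> to 0 leaves the part \<open>r\<close> of
  \<open>p\<close> whose monomials avoid \<open>B\<close>. If \<open>r\<close> were nonzero, it
  would be nonzero at a point without zero coordinates, contradicting the vanishing of
  \<open>p\<close>.\<close>

lemma supp_meets_if_vanishing:
  fixes p :: "nat cpoly"
  assumes p: "p \<in> polys_in {..n}"
    and 0: "\<And>a. (\<And>k. k \<in> B \<Longrightarrow> a k = 0) \<Longrightarrow> (\<And>k. k \<notin> B \<Longrightarrow> a k \<noteq> 0) \<Longrightarrow> eval_poly a p = 0"
    and m: "m \<in> monomials p"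
  shows "supp m \<inter> B \<noteq> {}"
proof
  assume disj: "supp m \<inter> B = {}"
  let ?R = "{m \<in> monomials p. supp m \<inter> B = {}}"
  define r where "r = (\<Sum>m\<in>?R. Poly_Mapping.single m (coeff_of p m))"
  have coeff_r: "coeff_of r m' = (if m' \<in> ?R then coeff_of p m' else 0)" for m'
    by (simp add: r_def lookup_sum lookup_single when_def)
  have "coeff_of r m \<noteq> 0"
    using m disj by (simp add: coeff_r monomials_def in_keys_iff)
  then have r0: "r \<noteq> 0" by auto
  have "monomials r \<subseteq> monomials p"
    unfolding monomials_def by (auto simp: in_keys_iff coeff_r split: if_splits)
  then have "r \<in> polys_in {..n}"
    using p unfolding polys_in_def by blast
  then obtain a where a: "\<And>k. a k \<noteq> 0" "eval_poly a r \<noteq> 0"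
    using eval_poly_nonzero[OF _ r0] by blast
  define b where "b k = (if k \<in> B then 0 else a k)" for k
  have "eval_monomial b m' = (if supp m' \<inter> B = {} then eval_monomial a m' else 0)" for m'
  proof (cases "supp m' \<inter> B = {}")
    case True
    then show ?thesis
      unfolding eval_monomial_def by (auto intro!: prod.cong simp: b_def)
  next
    case False
    then obtain k where "k \<in> supp m'" "k \<in> B" by blast
    then show ?thesis
      by (auto simp: eval_monomial_def b_def supp_def in_keys_iff intro!: prod_zero)
  qed
  then have "eval_poly b p = (\<Sum>m\<in>monomials p. if supp m \<inter> B = {} then coeff_of p m * eval_monomial a m else 0)"
    unfolding eval_poly_superset[OF finite_monomials order_refl] by (intro sum.cong) auto
  also have "\<dots> = eval_poly a r"
    by (simp add: r_def eval_poly_sum sum.If_cases Int_def)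
  finally show False
    using 0[of b] a by (auto simp: b_def)
qed

section \<open>Mixed determinants of a pencil\<close>

lemma multi_indices_tensor:
  assumes "n > 0"
  shows "multi_indices [n - 1, n - 1, 1] = (\<lambda>(i, j, s). [i, j, s]) ` ({1..n} \<times> {1..n} \<times> {1, 2})"
proof (intro equalityI subsetI)
  fix v assume v: "v \<in> multi_indices [n - 1, n - 1, 1]"
  then obtain i j s where ijs: "v = [i, j, s]"
    by (auto simp: multi_indices_def length_Suc_conv numeral_3_eq_3)
  have "1 \<le> [i, j, s] ! k \<and> [i, j, s] ! k \<le> [n - 1, n - 1, 1] ! k + 1" if "k < 3" for k
    using v that by (auto simp: ijs multi_indices_def)
  from this[of 0] this[of 1] this[of 2] have "(i, j, s) \<in> {1..n} \<times> {1..n} \<times> {1, 2}"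
    using assms by auto
  then show "v \<in> (\<lambda>(i, j, s). [i, j, s]) ` ({1..n} \<times> {1..n} \<times> {1, 2})"
    unfolding ijs by (intro image_eqI[of _ _ "(i, j, s)"]) simp_all
next
  fix v assume "v \<in> (\<lambda>(i, j, s). [i, j, s]) ` ({1..n} \<times> {1..n} \<times> {1, 2 :: nat})"
  then show "v \<in> multi_indices [n - 1, n - 1, 1]"
    using assms by (auto simp: multi_indices_def less_Suc_eq numeral_3_eq_3 nth_Cons')
qed

lemma tensor_index_iff:
  assumes "n > 0"
  shows "[i, j, s] \<in> multi_indices [n - 1, n - 1, 1] \<longleftrightarrow> i \<in> {1..n} \<and> j \<in> {1..n} \<and> s \<in> {1, 2}"
proof -
  have "inj (\<lambda>(i, j, s). [i, j, s :: nat])"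
    by (auto simp: inj_on_def)
  from inj_image_mem_iff[OF this, of "(i, j, s)" "{1..n} \<times> {1..n} \<times> {1, 2}"] show ?thesis
    unfolding multi_indices_tensor[OF assms] by simp
qed

lemma prod_multi_indices_tensor:
  assumes "n > 0"
  shows "(\<Prod>v\<in>multi_indices [n - 1, n - 1, 1]. f v) = (\<Prod>i=1..n. \<Prod>j=1..n. f [i, j, 1] * f [i, j, 2])"
proof -
  have "(\<Prod>v\<in>multi_indices [n - 1, n - 1, 1]. f v) =
      (\<Prod>(i, j, s)\<in>{1..n} \<times> {1..n} \<times> {1, 2}. f [i, j, s])"
    unfolding multi_indices_tensor[OF assms]
    by (subst prod.reindex) (auto simp: inj_on_def case_prod_unfold)
  then show ?thesis
    by (simp flip: prod.cartesian_product)
qed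

text \<open>Scaling the slices by \<open>s\<close> and \<open>t\<close> multiplies a monomial by
  powers given by its slice degrees. Hence the mixed determinants take as values the coefficients of
  the binary form \<open>det (s X + t Y)\<close>.\<close>

lemma eval_mixed_det:
  assumes n: "n > 0"
    and det: "\<And>z. det (mat n n (\<lambda>(i, j). z * a [i + 1, j + 1, 1] + a [i + 1, j + 1, 2])) =
      (\<Sum>k\<le>n. c k * z ^ k)"
    and k: "k \<le> n"
  shows "eval_poly a (mixed_det n k) = c k"
proof -
  let ?I = "multi_indices [n - 1, n - 1, 1]"
  let ?d = "slice_degree n"
  define P where "P = det (matX n + matY n)"
  \<comment> \<open>Position 2, counted from 0, holds the third subscript, which selects the
    slice.\<close>
  define b where "b s t v = (if v ! 2 = 1 then s else t) * a v" for s t :: complex and v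
  have "P \<in> polys_in ?I"
    unfolding P_def
  proof (rule polys_in_det)
    show "matX n + matY n \<in> carrier_mat n n"
      by (simp add: slice_def)
    fix i j assume "i < n" "j < n"
    then have "(matX n + matY n) $$ (i, j) = Var [i + 1, j + 1, 1] + Var [i + 1, j + 1, 2]"
      by (simp add: slice_def)
    also have "\<dots> \<in> polys_in ?I"
      using \<open>i < n\<close> \<open>j < n\<close>
      by (intro polys_in_add polys_in_Var tensor_index_iff[OF n, THEN iffD2]) auto
    finally show "(matX n + matY n) $$ (i, j) \<in> polys_in ?I" .
  qed
  then have supp: "supp m \<subseteq> ?I" if "m \<in> monomials P" for m
    using that by (simp add: polys_in_def)
  have scaled: "eval_monomial (b s t) m = eval_monomial a m * s ^ ?d 1 m * t ^ ?d 2 m"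
    if "m \<in> monomials P" for s t m
    unfolding eval_monomial_superset[OF finite_multi_indices supp[OF that]]
      prod_multi_indices_tensor[OF n] slice_degree_def
    by (simp add: b_def power_mult_distrib prod.distrib power_sum mult_ac)
  have "(\<Sum>m\<in>monomials P. coeff_of P m * eval_monomial a m * s ^ ?d 1 m * t ^ ?d 2 m) =
      (\<Sum>k\<le>n. c k * s ^ k * t ^ (n - k))" if t: "t \<noteq> 0" for s t
  proof -
    \<comment> \<open>The hypothesis concerns \<open>z X + Y\<close>: putting
      \<open>z = s / t\<close> and extracting \<open>t\<close> from the matrix homogenizes it, with
      a factor \<open>t ^ n\<close>.\<close>
    let ?A = "mat n n (\<lambda>(i, j). (s / t) * a [i + 1, j + 1, 1] + a [i + 1, j + 1, 2])"
    have "(\<Sum>m\<in>monomials P. coeff_of P m * eval_monomial a m * s ^ ?d 1 m * t ^ ?d 2 m) =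
        eval_poly (b s t) P"
      by (simp add: eval_poly_superset[OF finite_monomials order_refl] scaled mult_ac)
    also have "\<dots> = det (map_mat (eval_poly (b s t)) (matX n + matY n))"
      by (simp add: P_def)
    also have "map_mat (eval_poly (b s t)) (matX n + matY n) = t \<cdot>\<^sub>m ?A"
      using t by (intro eq_matI) (auto simp: slice_def eval_poly_add b_def field_simps)
    also have "det (t \<cdot>\<^sub>m ?A) = t ^ n * (\<Sum>k\<le>n. c k * (s / t) ^ k)"
      using det[of "s / t"] by simp
    also have "\<dots> = (\<Sum>k\<le>n. c k * s ^ k * t ^ (n - k))"
      unfolding sum_distrib_left
      using t by (intro sum.cong) (auto simp: power_diff power_divide field_simps)
    finally show ?thesis .
  qed
  note eq = this
  define C where "C m = coeff_of P m * eval_monomial a m" for m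
  \<comment> \<open>Coefficients are compared first in \<open>s\<close> for fixed nonzero
    \<open>t\<close>, then in \<open>t\<close>.\<close>
  define p where "p t = (\<Sum>m\<in>monomials P. Polynomial.monom (C m * t ^ ?d 2 m) (?d 1 m))" for t
  define q where "q t = (\<Sum>k\<le>n. Polynomial.monom (c k * t ^ (n - k)) k)" for t
  have "p t = q t" if "t \<noteq> 0" for t
  proof -
    have "poly (p t) s = poly (q t) s" for s
      using eq[OF that, of s] by (simp add: p_def q_def C_def poly_sum poly_monom mult_ac)
    then show ?thesis
      by (simp add: poly_eq_poly_eq_iff[symmetric] fun_eq_iff)
  qed
  then have "Polynomial.coeff (p t) k = Polynomial.coeff (q t) k" if "t \<noteq> 0" for t
    using that by simp
  then have k_coeff: "(\<Sum>m\<in>{m \<in> monomials P. ?d 1 m = k}. C m * t ^ ?d 2 m) =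
      c k * t ^ (n - k)"
    if "t \<noteq> 0" for t
    using k that by (simp add: p_def q_def coeff_sum sum.If_cases Int_def)
  have "(\<Sum>m\<in>{m \<in> monomials P. ?d 1 m = k}. Polynomial.monom (C m) (?d 2 m))
      = Polynomial.monom (c k) (n - k)"
    by (rule poly_eq_if_eq_nonzero) (simp add: poly_sum poly_monom k_coeff del: One_nat_def)
  then have "Polynomial.coeff (\<Sum>m\<in>{m \<in> monomials P. ?d 1 m = k}. Polynomial.monom (C m) (?d 2 m))
      (n - k) = c k"
    by simp
  then have "(\<Sum>m\<in>{m \<in> {m \<in> monomials P. ?d 1 m = k}. ?d 2 m = n - k}. C m) = c k"
    by (simp add: coeff_sum sum.If_cases Int_def)
  then show ?thesis
    unfolding mixed_det_def bihomogeneous_part_def P_def[symmetric]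
    by (simp add: eval_poly_sum C_def conj_assoc)
qed

section \<open>Pencils with prescribed determinant\<close>

text \<open>The nonzero top coefficient makes the degree exactly \<open>d\<close>, so the
  fundamental theorem of algebra supplies \<open>d\<close> roots with multiplicity.\<close>

lemma sum_powers_eq_prod_roots:
  fixes c :: "nat \<Rightarrow> complex"
  assumes "c d \<noteq> 0"
  obtains r where "\<And>z. (\<Sum>k\<le>d. c k * z ^ k) = c d * (\<Prod>i<d. z - r i)"
proof -
  define p where "p = (\<Sum>k\<le>d. Polynomial.monom (c k) k)"
  have coeff: "Polynomial.coeff p k = (if k \<le> d then c k else 0)" for k
    by (auto simp: p_def coeff_sum)
  have deg: "degree p = d"
    using assms by (intro antisym degree_le le_degree) (auto simp: coeff)
  obtain r where r: "smult (lead_coeff p) (\<Prod>i<degree p. [:-r i, 1:]) = p"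
    by (rule complex_poly_decompose')
  have "(\<Sum>k\<le>d. c k * z ^ k) = c d * (\<Prod>i<d. z - r i)" for z
  proof -
    have "(\<Sum>k\<le>d. c k * z ^ k) = poly p z"
      by (simp add: p_def poly_sum poly_monom)
    also have "\<dots> = poly (smult (lead_coeff p) (\<Prod>i<degree p. [:-r i, 1:])) z"
      by (simp only: r)
    also have "\<dots> = c d * (\<Prod>i<d. z - r i)"
      by (simp add: deg coeff poly_prod)
    finally show ?thesis .
  qed
  then show ?thesis by (rule that)
qed

text \<open>Both slices vanish at \<open>(0, 0)\<close>, and the second one in the whole row and column of index 0:
  this makes the tensor tangent to the Segre variety while leaving the determinant free up to its
  double root at 0.\<close>

lemma det_pencil:
  assumes "n \<ge> 2"
  shows "det (mat n n (\<lambda>(i, j). z * (if i = 0 \<and> j = 1 then 1 else if i = 1 \<and> j = 0 then - e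
      else if i = j \<and> i \<ge> 2 then 1 else 0) + (if i = j \<and> i \<ge> 2 then - r (i - 2) else 0))) =
    (e :: complex) * z\<^sup>2 * (\<Prod>i<n - 2. z - r i)" (is "det ?M = _")
proof -
  \<comment> \<open>Swapping the first two rows makes the matrix diagonal; its sign cancels the one
    in the entry \<open>- e\<close>.\<close>
  define D where "D = swaprows 0 1 ?M"
  have dim: "D \<in> carrier_mat n n"
    by (simp add: D_def)
  have D: "D $$ (i, j) = (if i = j then if i = 0 then - e * z else if i = 1 then z else z - r (i - 2) else 0)"
    if "i < n" "j < n" for i j
    using assms that by (auto simp: D_def)
  have "det ?M = - det D"
    using assms unfolding D_def by (subst det_swaprows[of 0 n 1 ?M]) auto
  also have "det D = prod_list (diag_mat D)"
    by (rule det_upper_triangular[OF _ dim]) (use dim in \<open>auto simp: D\<close>)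
  also have "\<dots> = (\<Prod>i<n. if i = 0 then - e * z else if i = 1 then z else z - r (i - 2))"
    unfolding prod_list_diag_prod using dim by (intro prod.cong) (auto simp: D)
  also have "\<dots> = - e * z\<^sup>2 * (\<Prod>i<n - 2. z - r i)"
  proof -
    obtain m where m: "n = Suc (Suc m)"
      using assms by (metis add_2_eq_Suc le_Suc_ex)
    show ?thesis
      unfolding m by (simp add: prod.lessThan_Suc_shift power2_eq_square del: prod.lessThan_Suc)
  qed
  finally show ?thesis by simp
qed

text \<open>Since \<open>c 0 = c 1 = 0\<close>, the polynomial with coefficients \<open>c k\<close>
  is \<open>z\<^sup>2\<close> times one of degree \<open>n - 2\<close> with leading coefficient
  \<open>c n\<close>. The roots of that cofactor become diagonal entries of the pencil.\<close>

lemma double_root_tensor: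
  fixes c :: "nat \<Rightarrow> complex"
  assumes n: "n \<ge> 2" and c: "c 0 = 0" "c 1 = 0" "c n \<noteq> 0"
  obtains a where "a \<in> vecs (multi_indices [n - 1, n - 1, 1])" "a \<noteq> 0"
    "\<And>\<beta>. \<beta> \<in> neighbours [n - 1, n - 1, 1] [1, 1, 2] \<Longrightarrow> a \<beta> = 0"
    "\<And>k. k \<le> n \<Longrightarrow> eval_poly a (mixed_det n k) = c k"
proof -
  let ?l = "[n - 1, n - 1, 1]"
  obtain m where m: "n = Suc (Suc m)"
    using n by (metis add_2_eq_Suc le_Suc_ex)
  obtain r where r: "\<And>z. (\<Sum>k\<le>m. c (k + 2) * z ^ k) = c (m + 2) * (\<Prod>i<m. z - r i)"
    using sum_powers_eq_prod_roots[of "\<lambda>k. c (k + 2)" m] c(3) m by auto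
  define A :: "nat \<Rightarrow> nat \<Rightarrow> complex" where "A i j =
    (if i = 0 \<and> j = 1 then 1 else if i = 1 \<and> j = 0 then - c n else if i = j \<and> i \<ge> 2 then 1 else 0)" for i j
  define B :: "nat \<Rightarrow> nat \<Rightarrow> complex" where "B i j = (if i = j \<and> i \<ge> 2 then - r (i - 2) else 0)" for i j
  \<comment> \<open>Subtracting 1 converts tensor subscripts to matrix indices starting at
    0.\<close>
  define a where "a v = (if v \<in> multi_indices ?l
    then (if v ! 2 = 1 then A else B) (v ! 0 - 1) (v ! 1 - 1) else 0)" for v
  have a_simps: "a [i + 1, j + 1, 1] = A i j" "a [i + 1, j + 1, 2] = B i j" if "i < n" "j < n" for i j
    using that n tensor_index_iff[of n "i + 1" "j + 1" 1] tensor_index_iff[of n "i + 1" "j + 1" 2]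
    by (simp_all add: a_def)
  have det: "det (mat n n (\<lambda>(i, j). z * a [i + 1, j + 1, 1] + a [i + 1, j + 1, 2])) = (\<Sum>k\<le>n. c k * z ^ k)"
    for z
  proof -
    have "mat n n (\<lambda>(i, j). z * a [i + 1, j + 1, 1] + a [i + 1, j + 1, 2]) = mat n n (\<lambda>(i, j). z * A i j + B i j)"
      by (rule cong_mat) (simp_all only: a_simps prod.case)
    also have "det \<dots> = c n * z\<^sup>2 * (\<Prod>i<n - 2. z - r i)"
      unfolding A_def B_def by (rule det_pencil[OF n])
    also have "\<dots> = z\<^sup>2 * (\<Sum>k\<le>m. c (k + 2) * z ^ k)"
      unfolding r by (simp add: m)
    also have "\<dots> = (\<Sum>k\<le>n. c k * z ^ k)"
      unfolding m sum.atMost_Suc_shift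
      using c by (simp add: sum_distrib_left power2_eq_square mult_ac)
    finally show ?thesis .
  qed
  show ?thesis
  proof (rule that[of a])
    show "a \<in> vecs (multi_indices ?l)"
      by (simp add: a_def vecs_def)
    have "a [1, 2, 1] = 1"
      using a_simps(1)[of 0 1] n by (simp add: A_def numeral_2_eq_2)
    then show "a \<noteq> 0"
      by (metis zero_fun_apply zero_neq_one)
    show "eval_poly a (mixed_det n k) = c k" if "k \<le> n" for k
      using n that by (intro eval_mixed_det det) auto
  next
    fix \<beta> assume \<beta>: "\<beta> \<in> neighbours ?l [1, 1, 2]"
    then obtain k where k: "k < 3" "\<And>j. j < 3 \<Longrightarrow> j \<noteq> k \<Longrightarrow> \<beta> ! j = [1, 1, 2] ! j"
      by (auto simp: neighbours_def numeral_3_eq_3)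
    then have "k = 0 \<or> k = 1 \<or> k = 2" by auto
    \<comment> \<open>The neighbours lie in the first row or first column of the second slice, or in
      the corner of either slice; \<open>A\<close> and \<open>B\<close> are 0 there.\<close>
    then have "\<beta> ! 0 = 1 \<and> \<beta> ! 2 = 2 \<or> \<beta> ! 1 = 1 \<and> \<beta> ! 2 = 2 \<or> \<beta> ! 0 = 1 \<and> \<beta> ! 1 = 1"
      using k(2)[of 0] k(2)[of 1] k(2)[of 2] by auto
    then show "a \<beta> = 0"
      by (auto simp: a_def A_def B_def)
  qed
qed

theorem corollary5p9:
  fixes n :: nat and \<Phi> :: "nat cpoly" and H :: "nat list cpoly"
  assumes "n \<ge> 2"
    and "is_hyperdeterminant [n - 1, n - 1, 1] H"
    and "\<Phi> \<in> polys_in {0..n}"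
    and "subst_poly (mixed_det n) \<Phi> = H"
  shows "supp (lm \<Phi>) \<inter> {0, 1} \<noteq> {}"
proof (rule supp_meets_if_vanishing)
  show "\<Phi> \<in> polys_in {..n}"
    using assms(3) by (simp add: atLeast0AtMost)
next
  fix c :: "nat \<Rightarrow> complex"
  assume "\<And>k. k \<in> {0, 1} \<Longrightarrow> c k = 0" "\<And>k. k \<notin> {0, 1} \<Longrightarrow> c k \<noteq> 0"
  then have c: "c 0 = 0" "c 1 = 0" "c n \<noteq> 0"
    using assms(1) by auto
  obtain a where a: "a \<in> vecs (multi_indices [n - 1, n - 1, 1])" "a \<noteq> 0"
    "\<And>\<beta>. \<beta> \<in> neighbours [n - 1, n - 1, 1] [1, 1, 2] \<Longrightarrow> a \<beta> = 0"
    and eval: "\<And>k. k \<le> n \<Longrightarrow> eval_poly a (mixed_det n k) = c k"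
    using double_root_tensor[OF assms(1) c] by blast
  \<comment> \<open>The two points agree for \<open>k \<le> n\<close>, and only these indeterminates
    occur in \<Phi>.\<close>
  have "eval_poly c \<Phi> = eval_poly (\<lambda>k. eval_poly a (mixed_det n k)) \<Phi>"
    using eval by (intro eval_poly_cong_in[OF assms(3)]) auto
  also have "\<dots> = eval_poly a H"
    by (simp add: assms(4)[symmetric] eval_poly_subst)
  also have "\<dots> = 0"
    using assms(1) tensor_index_iff[of n 1 1 2]
    by (intro hyperdeterminant_eval_0[OF assms(2) _ _ a]) simp_all
  finally show "eval_poly c \<Phi> = 0" .
next
  have "\<Phi> \<noteq> 0"
  proof
    assume "\<Phi> = 0"
    \<comment> \<open>A defining polynomial is not constant, which excludes
      \<open>\<Phi> = 0\<close>.\<close>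
    then have "H = Const 0"
      using assms(4) by (simp add: subst_poly_def monomials_def Const_def)
    then show False
      using assms(2) by (simp add: is_hyperdeterminant_def is_defining_polynomial_def)
  qed
  then show "lm \<Phi> \<in> monomials \<Phi>"
    by (rule lm_in_monomials)
qed

end
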